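(* Let $\tau>0$, let $A$ be a constant real $2\times2$ matrix, and let $\Delta A(t)=[\Delta a_{ij}(t)]$ be a $2\times 2$ matrix of continuous real functions on $[0,\infty)$ satisfying $|\Delta a_{ij}(t)|\le\bar a_{ij}$, $i,j=1,2$, for some positive constants $\bar a_{ij}$. Consider the perturbed system $$u'(t)=Au(t-\tau)+\Delta A(t)u(t-\tau).$$ (a) If the equilibrium $u=0$ of $u'(t)=Au(t-\tau)$ is stable and there exists $\eta:[0,\infty)\to\mathbb R$ with $\int_0^\infty\eta(t)\,dt<\infty$ such that $\|\Delta A(t)\|\le\eta(t)$ for all $t\ge0$, then the perturbed system is uniformly stable on $[0,\infty)$. (b) If the equilibrium $u=0$ of $u'(t)=Au(t-\tau)$ is exponentially asymptotically stable, then there exists $\eta>0$ such that, if $|\Delta a_{ij}(t)|<\eta$ for all $t\ge0$ and $i,j=1,2$, the perturbed system is exponentially asymptotically stable.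
   Context: The phase space is $C=C([-\tau,0];\mathbb R^2)$ with the supremum norm, and $\|\Delta A(t)\|$ is a matrix operator norm. Let $u(t,s,\phi)$ be the solution with $u(s+\theta)=\phi(\theta)$ for $\theta\in[-\tau,0]$, $s\ge0$. A linear system is uniformly stable on $[0,\infty)$ if its zero solution is stable with $\delta(\varepsilon)$ independent of the initial time $s\ge0$; it is exponentially asymptotically stable (EAS) if there are $K,\beta>0$ with $|u(t,s,\phi)|\le Ke^{-\beta(t-s)}\|\phi\|$ for all $t\ge s\ge0$, $\phi\in C$. *)

theory Defs
  imports "HOL-Analysis.Analysis"
begin

text \<open>
  Delay equations \<open>u'(t) = F t (u (t - \<tau>))\<close> in the plane, with \<open>F\<close> used only for times
  \<open>t \<ge> 0\<close>. An element of \<open>C([-\<tau>,0]; \<real>\<^sup>2)\<close> is represented by a total function that is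
  continuous on \<open>{-\<tau>..0}\<close>; its values outside that interval are never used. Vectors carry
  the Euclidean norm.
\<close>

definition phase_space :: "real \<Rightarrow> (real \<Rightarrow> real^2) set" where
  "phase_space \<tau> = {\<phi>. continuous_on {-\<tau>..0} \<phi>}"

definition phase_norm :: "real \<Rightarrow> (real \<Rightarrow> real^2) \<Rightarrow> real" where
  "phase_norm \<tau> \<phi> = (SUP \<theta>\<in>{-\<tau>..0}. norm (\<phi> \<theta>))"

text \<open>
  \<open>u\<close> is a solution on \<open>{s - \<tau>..}\<close> with initial function \<open>\<phi>\<close> at time \<open>s\<close>; the derivative
  is one-sided at \<open>t = s\<close> (and two-sided at every \<open>t > s\<close>).
\<close>

definition dde_solution ::
  "real \<Rightarrow> (real \<Rightarrow> real^2 \<Rightarrow> real^2) \<Rightarrow> real \<Rightarrow> (real \<Rightarrow> real^2) \<Rightarrow> (real \<Rightarrow> real^2) \<Rightarrow> bool" where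
  "dde_solution \<tau> F s \<phi> u \<longleftrightarrow>
     continuous_on {s - \<tau>..} u \<and>
     (\<forall>\<theta>\<in>{-\<tau>..0}. u (s + \<theta>) = \<phi> \<theta>) \<and>
     (\<forall>t\<ge>s. (u has_vector_derivative F t (u (t - \<tau>))) (at t within {s..}))"

definition dde_stable :: "real \<Rightarrow> (real \<Rightarrow> real^2 \<Rightarrow> real^2) \<Rightarrow> bool" where
  "dde_stable \<tau> F \<longleftrightarrow>
     (\<forall>s\<ge>0. \<forall>\<epsilon>>0. \<exists>\<delta>>0. \<forall>\<phi>\<in>phase_space \<tau>. \<forall>u.
        dde_solution \<tau> F s \<phi> u \<longrightarrow> phase_norm \<tau> \<phi> < \<delta> \<longrightarrow> (\<forall>t\<ge>s. norm (u t) < \<epsilon>))"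

definition dde_uniformly_stable :: "real \<Rightarrow> (real \<Rightarrow> real^2 \<Rightarrow> real^2) \<Rightarrow> bool" where
  "dde_uniformly_stable \<tau> F \<longleftrightarrow>
     (\<forall>\<epsilon>>0. \<exists>\<delta>>0. \<forall>s\<ge>0. \<forall>\<phi>\<in>phase_space \<tau>. \<forall>u.
        dde_solution \<tau> F s \<phi> u \<longrightarrow> phase_norm \<tau> \<phi> < \<delta> \<longrightarrow> (\<forall>t\<ge>s. norm (u t) < \<epsilon>))"

definition dde_exp_asymp_stable :: "real \<Rightarrow> (real \<Rightarrow> real^2 \<Rightarrow> real^2) \<Rightarrow> bool" where
  "dde_exp_asymp_stable \<tau> F \<longleftrightarrow>
     (\<exists>K>0. \<exists>\<beta>>0. \<forall>s\<ge>0. \<forall>\<phi>\<in>phase_space \<tau>. \<forall>u.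
        dde_solution \<tau> F s \<phi> u \<longrightarrow>
        (\<forall>t\<ge>s. norm (u t) \<le> K * exp (- \<beta> * (t - s)) * phase_norm \<tau> \<phi>))"

definition admissible_perturbation :: "(real \<Rightarrow> real^2^2) \<Rightarrow> bool" where
  "admissible_perturbation \<Delta>A \<longleftrightarrow>
     (\<forall>i j. continuous_on {0..} (\<lambda>t. \<Delta>A t $ i $ j)) \<and>
     (\<exists>abar :: real^2^2. \<forall>i j. abar $ i $ j > 0 \<and> (\<forall>t\<ge>0. \<bar>\<Delta>A t $ i $ j\<bar> \<le> abar $ i $ j))"

end

theory Submission
  imports Defs
begin

text \<open>
  Both parts rest on a variation-of-constants argument carried out in steps of length \<open>\<tau>\<close>,
  so that no fundamental matrix (whose initial function is discontinuous) is needed.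

  Let \<open>u\<close> solve the perturbed system from time \<open>s\<close>, put \<open>r\<^sub>k = s + k \<tau>\<close>, and let \<open>x\<^sub>k\<close> solve the
  unperturbed system from time \<open>r\<^sub>k\<close> with the segment of \<open>u\<close> on \<open>[r\<^sub>k - \<tau>, r\<^sub>k]\<close> as initial
  function. On \<open>[r\<^sub>k, r\<^sub>k + \<tau>]\<close> the delayed values of \<open>u\<close> and \<open>x\<^sub>k\<close> coincide, so the
  unperturbed terms cancel exactly and \<open>(u - x\<^sub>k)' = \<Delta>A(t) u(t - \<tau>)\<close>. Hence
  \<open>u - x\<^sub>k\<close> is at most \<open>e\<^sub>k a\<^sub>k\<close> there, with \<open>e\<^sub>k\<close> the integral of \<open>\<eta>\<close> over that interval and
  \<open>a\<^sub>k\<close> the norm of the \<open>k\<close>-th segment (\<open>one_step_deviation\<close>). The difference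
  \<open>x\<^sub>k\<^sub>+\<^sub>1 - x\<^sub>k\<close> solves the unperturbed system from \<open>r\<^sub>k\<^sub>+\<^sub>1\<close>, and its initial function is this
  deviation, so a bound \<open>K exp (- \<beta> (t - s))\<close> for the unperturbed system controls it at all
  later times. Since the \<open>n\<close>-th segment of \<open>u\<close> is that of \<open>x\<^sub>n\<close>, telescoping bounds \<open>a\<^sub>n\<close> by
  \<open>a\<^sub>0\<close> and the earlier \<open>e\<^sub>k a\<^sub>k\<close>, and the discrete Gronwall inequality, applied to
  \<open>exp (\<beta> k \<tau>) a\<^sub>k\<close>, yields
  \<open>|u(t)| \<le> C exp (- \<beta> (t - s)) exp (C \<integral>\<^sub>s\<^sup>t\<^sup>+\<^sup>\<tau> \<eta>) \<parallel>\<phi>\<parallel>\<close> (\<open>perturbed_bound\<close>).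

  Part (a) is the case \<open>\<beta> = 0\<close>: the exponent stays below \<open>C \<integral>\<^sub>0\<^sup>\<infinity> \<eta>\<close>. The bound on
  the unperturbed system that does not depend on the initial time comes from stability at
  time \<open>0\<close> by linearity and translation in time (\<open>dde_stable_imp_uniform_bound\<close>). Part (b) is
  the case of constant \<open>\<eta>\<close>, taken so small that the growth \<open>exp (C \<eta> (t - s))\<close> consumes only
  half of the decay rate \<open>\<beta>\<close>.
\<close>

section \<open>The supremum norm on initial functions\<close>

lemma phase_norm_upper:
  assumes "\<phi> \<in> phase_space \<tau>" "\<theta> \<in> {-\<tau>..0}"
  shows "norm (\<phi> \<theta>) \<le> phase_norm \<tau> \<phi>"
proof -
  have "compact ((\<lambda>\<theta>. norm (\<phi> \<theta>)) ` {-\<tau>..0})"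
    using assms(1) unfolding phase_space_def
    by (intro compact_continuous_image continuous_intros) auto
  then have "bdd_above ((\<lambda>\<theta>. norm (\<phi> \<theta>)) ` {-\<tau>..0})"
    by (simp add: compact_imp_bounded bounded_imp_bdd_above)
  then show ?thesis
    unfolding phase_norm_def using assms(2) by (rule cSUP_upper2) auto
qed

lemma phase_norm_least:
  assumes "\<tau> \<ge> 0" "\<And>\<theta>. \<theta> \<in> {-\<tau>..0} \<Longrightarrow> norm (\<phi> \<theta>) \<le> N"
  shows "phase_norm \<tau> \<phi> \<le> N"
  unfolding phase_norm_def using assms by (intro cSUP_least) auto

lemma phase_norm_nonneg:
  assumes "\<tau> \<ge> 0" "\<phi> \<in> phase_space \<tau>"
  shows "phase_norm \<tau> \<phi> \<ge> 0"
proof -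
  have "0 \<le> norm (\<phi> 0)" by simp
  also have "\<dots> \<le> phase_norm \<tau> \<phi>"
    using assms by (intro phase_norm_upper) auto
  finally show ?thesis .
qed

section \<open>Operations on solutions\<close>

lemma dde_solution_continuous_on:
  "dde_solution \<tau> F s \<phi> u \<Longrightarrow> continuous_on {s-\<tau>..} u"
  by (simp add: dde_solution_def)

lemma dde_solution_initial:
  "dde_solution \<tau> F s \<phi> u \<Longrightarrow> r \<in> {s-\<tau>..s} \<Longrightarrow> u r = \<phi> (r - s)"
  unfolding dde_solution_def by (auto dest: bspec[of _ _ "r - s"])

lemma dde_solution_derivative:
  assumes "dde_solution \<tau> F s \<phi> u" "t \<ge> s" "S \<subseteq> {s..}"
  shows "(u has_vector_derivative F t (u (t - \<tau>))) (at t within S)"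
  using assms unfolding dde_solution_def
  by (blast intro: has_vector_derivative_within_subset)

lemma segment_in_phase_space:
  assumes "dde_solution \<tau> F s \<phi> u" "r \<ge> s"
  shows "(\<lambda>\<theta>. u (r + \<theta>)) \<in> phase_space \<tau>"
  unfolding phase_space_def mem_Collect_eq
  using assms(2)
  by (intro continuous_on_compose2[OF dde_solution_continuous_on[OF assms(1)]] continuous_intros)
     auto

text \<open>
  To see that \<open>x\<^sub>k\<^sub>+\<^sub>1 - x\<^sub>k\<close> solves the unperturbed system from \<open>r\<^sub>k\<^sub>+\<^sub>1\<close>, the older solution \<open>x\<^sub>k\<close>
  has to be restarted at that time.
\<close>

lemma dde_solution_restart:
  assumes "dde_solution \<tau> F s \<phi> u" "r \<ge> s"
  shows "dde_solution \<tau> F r (\<lambda>\<theta>. u (r + \<theta>)) u"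
  unfolding dde_solution_def
proof (intro conjI ballI allI impI)
  show "continuous_on {r-\<tau>..} u"
    using dde_solution_continuous_on[OF assms(1)] assms(2)
    by (rule_tac continuous_on_subset) auto
  show "(u has_vector_derivative F t (u (t - \<tau>))) (at t within {r..})" if "r \<le> t" for t
    using that assms by (intro dde_solution_derivative[OF assms(1)]) auto
qed simp

lemma dde_solution_diff:
  assumes "dde_solution \<tau> (\<lambda>t x. A *v x) s \<phi> x" "dde_solution \<tau> (\<lambda>t x. A *v x) s \<psi> y"
  shows "dde_solution \<tau> (\<lambda>t x. A *v x) s (\<lambda>\<theta>. \<phi> \<theta> - \<psi> \<theta>) (\<lambda>t. x t - y t)"
  using assms unfolding dde_solution_def
  by (auto intro!: continuous_intros derivative_eq_intros simp: matrix_vector_mult_diff_distrib)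

lemma dde_solution_scale:
  assumes "dde_solution \<tau> (\<lambda>t x. A *v x) s \<phi> x"
  shows "dde_solution \<tau> (\<lambda>t x. A *v x) s (\<lambda>\<theta>. c *\<^sub>R \<phi> \<theta>) (\<lambda>t. c *\<^sub>R x t)"
  using assms unfolding dde_solution_def
  by (auto intro!: continuous_intros derivative_eq_intros
      simp: matrix_vector_mult_scaleR)

text \<open>
  The right-hand side is autonomous; this is what makes the stability of the unperturbed
  system uniform in the initial time.
\<close>

lemma dde_solution_translate:
  assumes "dde_solution \<tau> (\<lambda>t. f) s \<phi> x"
  shows "dde_solution \<tau> (\<lambda>t. f) 0 \<phi> (\<lambda>t. x (s + t))"
  unfolding dde_solution_def
proof (intro conjI ballI allI impI)
  show "continuous_on {0-\<tau>..} (\<lambda>t. x (s + t))"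
    by (intro continuous_on_compose2[OF dde_solution_continuous_on[OF assms]] continuous_intros)
       auto
  show "x (s + (0 + \<theta>)) = \<phi> \<theta>" if "\<theta> \<in> {-\<tau>..0}" for \<theta>
    using dde_solution_initial[OF assms, of "s + \<theta>"] that by auto
  show "((\<lambda>t. x (s + t)) has_vector_derivative f (x (s + (t - \<tau>)))) (at t within {0..})"
    if "0 \<le> t" for t
  proof -
    have "(x has_vector_derivative f (x (s + t - \<tau>))) (at (s + t) within (+) s ` {0..})"
      using that by (intro dde_solution_derivative[OF assms]) auto
    then have "((x \<circ> (+) s) has_vector_derivative 1 *\<^sub>R f (x (s + t - \<tau>))) (at t within {0..})"
      by (intro vector_diff_chain_within) (auto intro!: derivative_eq_intros)
    then show ?thesis
      by (simp add: o_def add_diff_eq)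
  qed
qed

section \<open>Existence by the method of steps\<close>


lemma primitive_has_vector_derivative:
  fixes h :: "real \<Rightarrow> 'a::banach"
  assumes "continuous_on UNIV h" "s \<le> t"
  shows "((\<lambda>t. integral {s..t} h) has_vector_derivative h t) (at t within {s..})"
proof -
  have "((\<lambda>t. integral {s..t} h) has_vector_derivative h t) (at t within {s..t+1})"
    using assms by (intro integral_has_vector_derivative continuous_on_subset[OF assms(1)]) auto
  moreover have "at t within {s..t+1} = at t within {s..}"
    by (rule at_within_nhd[where S = "{..<t+1}"]) auto
  ultimately show ?thesis by simp
qed

lemma primitive_continuous_on:
  fixes h :: "real \<Rightarrow> 'a::banach"
  assumes "continuous_on UNIV h"
  shows "continuous_on UNIV (\<lambda>t. integral {s..t} h)"
proof -
  have "continuous_on {s..} (\<lambda>t. integral {s..t} h)"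
    using primitive_has_vector_derivative[OF assms]
    by (auto simp: continuous_on_eq_continuous_within intro: has_vector_derivative_continuous)
  then have "continuous_on UNIV (\<lambda>t. integral {s..max s t} h)"
    by (rule continuous_on_compose2) (auto intro!: continuous_intros)
  moreover have "integral {s..max s t} h = integral {s..t} h" for t
    by (cases "s \<le> t") (auto simp: max_def)
  ultimately show ?thesis by simp
qed

text \<open>
  The equation at time \<open>t\<close> involves only the past up to \<open>t - \<tau>\<close>, so each Picard iteration
  settles the solution on one further interval of length \<open>\<tau>\<close>: the \<open>n\<close>-th iterate is never
  changed again on \<open>{..s + n \<tau>}\<close>. Continuity of \<open>f\<close> is therefore enough. The comparison
  argument needs this lemma because the hypotheses on the unperturbed system speak only of
  solutions that are given.
\<close>

lemma dde_solution_exists: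
  assumes \<tau>: "\<tau> > 0" and \<phi>: "\<phi> \<in> phase_space \<tau>" and f: "continuous_on UNIV f"
  obtains u where "dde_solution \<tau> (\<lambda>t. f) s \<phi> u"
proof -
  \<comment> \<open>Extending the initial function by constants makes every iterate continuous on the whole
    line, and for \<open>t < s\<close> the integral over \<open>{s..t}\<close> vanishes, so one formula covers the initial
    interval and the future.\<close>
  define g where "g t = \<phi> (max (-\<tau>) (min 0 (t - s)))" for t
  have "continuous_on {-\<tau>..0} \<phi>"
    using \<phi> by (simp add: phase_space_def)
  then have g: "continuous_on UNIV g"
    unfolding g_def by (rule continuous_on_compose2) (use \<tau> in \<open>auto intro!: continuous_intros\<close>)
  define P where "P = rec_nat g (\<lambda>_ x t. g t + integral {s..t} (\<lambda>r. f (x (r - \<tau>))))"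
  have P0: "P 0 = g" and PS: "P (Suc n) = (\<lambda>t. g t + integral {s..t} (\<lambda>r. f (P n (r - \<tau>))))" for n
    by (simp_all add: P_def)
  have contF: "continuous_on UNIV (\<lambda>r. f (x (r - \<tau>)))" if "continuous_on UNIV x" for x
    by (intro continuous_on_compose2[OF f] continuous_on_compose2[OF that] continuous_intros) auto
  have contP: "continuous_on UNIV (P n)" for n
    by (induction n) (auto simp: P0 PS intro!: g continuous_on_add primitive_continuous_on contF)
  have agree_Suc: "P (Suc n) t = P n t" if "t \<le> s + real n * \<tau>" for n t
    using that
  proof (induction n arbitrary: t)
    case 0
    then show ?case by (cases "t = s") (auto simp: P0 PS)
  next
    case (Suc n)
    have "P (Suc n) (r - \<tau>) = P n (r - \<tau>)" if "r \<in> {s..t}" for r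
      using that Suc.prems by (intro Suc.IH) (auto simp: algebra_simps)
    then show ?case
      by (subst (1 2) PS) (auto intro: integral_cong)
  qed
  have agree: "P m t = P n t" if "n \<le> m" "t \<le> s + real n * \<tau>" for m n t
    using that(1)
  proof (induction m rule: dec_induct)
    case (step m)
    have "real n * \<tau> \<le> real m * \<tau>"
      using step \<tau> by simp
    then show ?case
      using step that(2) agree_Suc by auto
  qed simp
  define N where "N t = nat \<lceil>(t - s) / \<tau>\<rceil>" for t
  define u where "u t = P (N t) t" for t
  have u_eq: "u t = P n t" if "t \<le> s + real n * \<tau>" for t n
  proof -
    have "(t - s) / \<tau> \<le> real n"
      using that \<tau> by (simp add: field_simps)
    then have "N t \<le> n"
      unfolding N_def by linarith
    moreover have "(t - s) / \<tau> \<le> real (N t)"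
      unfolding N_def by linarith
    then have "t \<le> s + real (N t) * \<tau>"
      using \<tau> by (simp add: field_simps)
    ultimately show ?thesis
      unfolding u_def using agree by simp
  qed
  have ex: "\<exists>n. t < s + real n * \<tau>" for t
    using reals_Archimedean3[OF \<tau>, rule_format, of "t - s"] by (auto simp: algebra_simps)
  have "continuous_on (\<Union>n. {..<s + real n * \<tau>}) u"
  proof (rule continuous_on_open_UN)
    show "continuous_on {..<s + real n * \<tau>} u" for n
      using continuous_on_subset[OF contP[of n], of "{..<s + real n * \<tau>}"]
      by (rule continuous_on_eq) (auto intro!: u_eq[symmetric])
  qed auto
  moreover have "(\<Union>n. {..<s + real n * \<tau>}) = UNIV"
    using ex by auto
  ultimately have contu: "continuous_on UNIV u" by simp
  have fixpoint: "u t = g t + integral {s..t} (\<lambda>r. f (u (r - \<tau>)))" for t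
  proof -
    obtain n where n: "t < s + real n * \<tau>" using ex by blast
    have "u t = P (Suc n) t"
      using n \<tau> by (intro u_eq) (auto simp: algebra_simps)
    also have "\<dots> = g t + integral {s..t} (\<lambda>r. f (u (r - \<tau>)))"
      unfolding PS using n \<tau> by (auto intro!: integral_cong arg_cong[of _ _ f] simp: u_eq[of _ n])
    finally show ?thesis .
  qed
  have "dde_solution \<tau> (\<lambda>t. f) s \<phi> u"
    unfolding dde_solution_def
  proof (intro conjI ballI allI impI)
    show "continuous_on {s - \<tau>..} u"
      using contu continuous_on_subset by blast
    show "u (s + \<theta>) = \<phi> \<theta>" if "\<theta> \<in> {-\<tau>..0}" for \<theta>
      using that u_eq[of "s + \<theta>" 0] by (auto simp: P0 g_def)
    show "(u has_vector_derivative f (u (t - \<tau>))) (at t within {s..})" if "s \<le> t" for t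
    proof (rule has_vector_derivative_transform)
      show "u r = \<phi> 0 + integral {s..r} (\<lambda>r. f (u (r - \<tau>)))" if "r \<in> {s..}" for r
        using that \<tau> by (subst fixpoint) (auto simp: g_def)
      show "((\<lambda>r. \<phi> 0 + integral {s..r} (\<lambda>r. f (u (r - \<tau>)))) has_vector_derivative f (u (t - \<tau>)))
              (at t within {s..})"
        using has_vector_derivative_add[OF has_vector_derivative_const
          primitive_has_vector_derivative[OF contF[OF contu] \<open>s \<le> t\<close>]] by simp
    qed (use \<open>s \<le> t\<close> in auto)
  qed
  then show thesis by (rule that)
qed

section \<open>Uniform bounds for the unperturbed system\<close>

text \<open>
  The \<open>\<delta>\<close> that stability supplies for \<open>\<epsilon> = 1\<close> at initial time \<open>0\<close> serves every solution:
  translate it to start at \<open>0\<close> and rescale its initial function to norm below \<open>\<delta>\<close>.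
\<close>

lemma dde_stable_imp_uniform_bound:
  assumes \<tau>: "\<tau> > 0" and stable: "dde_stable \<tau> (\<lambda>t x. A *v x)"
  obtains K where "K > 0"
    "\<And>s \<phi> x t. \<phi> \<in> phase_space \<tau> \<Longrightarrow> dde_solution \<tau> (\<lambda>t x. A *v x) s \<phi> x \<Longrightarrow> t \<ge> s \<Longrightarrow>
       norm (x t) \<le> K * phase_norm \<tau> \<phi>"
proof -
  from stable obtain \<delta> where \<delta>: "\<delta> > 0"
    "\<And>\<phi> x t. \<phi> \<in> phase_space \<tau> \<Longrightarrow> dde_solution \<tau> (\<lambda>t x. A *v x) 0 \<phi> x \<Longrightarrow>
        phase_norm \<tau> \<phi> < \<delta> \<Longrightarrow> t \<ge> 0 \<Longrightarrow> norm (x t) < 1"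
    unfolding dde_stable_def by (metis order_refl zero_less_one)
  have "norm (x t) \<le> (1 / \<delta>) * phase_norm \<tau> \<phi>"
    if \<phi>: "\<phi> \<in> phase_space \<tau>" and x: "dde_solution \<tau> (\<lambda>t x. A *v x) s \<phi> x" and "t \<ge> s"
    for s \<phi> x t
  proof -
    \<comment> \<open>Rescaling by \<open>\<delta> / N\<close> for all \<open>N\<close> above the norm, instead of by the norm itself, includes
      the zero initial function.\<close>
    have "\<delta> * norm (x t) \<le> N" if N: "phase_norm \<tau> \<phi> < N" for N
    proof -
      have "N > 0"
        using N phase_norm_nonneg[of \<tau> \<phi>] \<phi> \<tau> by simp
      define c where "c = \<delta> / N"
      have "c > 0" using \<open>N > 0\<close> \<delta>(1) by (simp add: c_def)
      have "phase_norm \<tau> (\<lambda>\<theta>. c *\<^sub>R \<phi> \<theta>) \<le> c * phase_norm \<tau> \<phi>"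
        using \<tau> \<phi> \<open>c > 0\<close> by (intro phase_norm_least) (auto intro!: phase_norm_upper)
      also have "\<dots> < c * N"
        using N \<open>c > 0\<close> by simp
      also have "\<dots> = \<delta>"
        using \<open>N > 0\<close> by (simp add: c_def)
      finally have small: "phase_norm \<tau> (\<lambda>\<theta>. c *\<^sub>R \<phi> \<theta>) < \<delta>" .
      have "(\<lambda>\<theta>. c *\<^sub>R \<phi> \<theta>) \<in> phase_space \<tau>"
        using \<phi> unfolding phase_space_def by (auto intro!: continuous_intros)
      from \<delta>(2)[OF this dde_solution_scale[OF dde_solution_translate[OF x]] small, of "t - s"]
      have "c * norm (x t) < 1"
        using \<open>t \<ge> s\<close> \<open>c > 0\<close> by simp
      then show ?thesis
        using \<open>N > 0\<close> by (simp add: c_def field_simps)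
    qed
    then have "\<delta> * norm (x t) \<le> phase_norm \<tau> \<phi>"
      by (rule dense_ge)
    then show ?thesis
      using \<delta>(1) by (simp add: field_simps)
  qed
  then show thesis
    using that[of "1 / \<delta>"] \<delta>(1) by auto
qed

text \<open>
  On the initial interval the exponential factor is at least \<open>1\<close>, so for \<open>K \<ge> 1\<close> the decay
  estimate holds there as well. The deviations are measured on whole segments, part of which
  lies before the time at which the newest comparison solution starts.
\<close>

lemma decay_from_start_of_segment:
  assumes \<tau>: "\<tau> \<ge> 0" and "\<beta> \<ge> 0" "K \<ge> 1" and \<phi>: "\<phi> \<in> phase_space \<tau>"
    and x: "dde_solution \<tau> F s \<phi> x"
    and decay: "\<And>t. t \<ge> s \<Longrightarrow> norm (x t) \<le> K * exp (- \<beta> * (t - s)) * phase_norm \<tau> \<phi>"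
    and "t \<ge> s - \<tau>"
  shows "norm (x t) \<le> K * exp (- \<beta> * (t - s)) * phase_norm \<tau> \<phi>"
proof (cases "t \<ge> s")
  case False
  then have "norm (x t) \<le> 1 * phase_norm \<tau> \<phi>"
    using dde_solution_initial[OF x, of t] phase_norm_upper[OF \<phi>, of "t - s"] \<open>t \<ge> s - \<tau>\<close> by simp
  also have "\<dots> \<le> K * exp (- \<beta> * (t - s)) * phase_norm \<tau> \<phi>"
  proof (rule mult_right_mono)
    have "1 \<le> exp (- \<beta> * (t - s))"
      using False \<open>\<beta> \<ge> 0\<close> by (simp add: mult_nonneg_nonpos)
    then show "1 \<le> K * exp (- \<beta> * (t - s))"
      using \<open>K \<ge> 1\<close> mult_mono[of 1 K 1 "exp (- \<beta> * (t - s))"] by simp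
  qed (rule phase_norm_nonneg[OF \<tau> \<phi>])
  finally show ?thesis .
qed (rule decay)

section \<open>One delay interval of the perturbed system\<close>

text \<open>
  Within one delay of the common initial time both solutions still see the same delayed values
  \<open>\<phi> (t - \<tau> - s)\<close>. Their difference therefore has derivative \<open>B t *v \<phi> (t - \<tau> - s)\<close>, and
  integrating it suffices; no Gronwall estimate in continuous time is involved.
\<close>

lemma one_step_deviation:
  fixes A :: "real^2^2" and B :: "real \<Rightarrow> real^2^2"
  assumes \<tau>: "\<tau> > 0"
    and u: "dde_solution \<tau> (\<lambda>t x. A *v x + B t *v x) s \<phi> u"
    and x: "dde_solution \<tau> (\<lambda>t x. A *v x) s \<phi> x"
    and \<phi>: "\<phi> \<in> phase_space \<tau>"
    and B: "\<And>t. t \<ge> s \<Longrightarrow> onorm (\<lambda>x. B t *v x) \<le> \<eta> t"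
    and \<eta>: "\<eta> integrable_on {s..s + \<tau>}"
    and t: "t \<in> {s..s + \<tau>}"
  shows "norm (u t - x t) \<le> integral {s..s + \<tau>} \<eta> * phase_norm \<tau> \<phi>"
proof -
  have nonneg: "\<eta> r \<ge> 0" if "r \<ge> s" for r
    using B[OF that] onorm_pos_le[OF matrix_vector_mul_bounded_linear[of "B r"]] by simp
  define w' where "w' r = A *v u (r - \<tau>) + B r *v u (r - \<tau>) - A *v x (r - \<tau>)" for r
  have "(w' has_integral ((u t - x t) - (u s - x s))) {s..t}"
    unfolding w'_def using t
    by (intro fundamental_theorem_of_calculus has_vector_derivative_diff
          dde_solution_derivative[OF u] dde_solution_derivative[OF x]) auto
  moreover have "u s = x s"
    using dde_solution_initial[OF u, of s] dde_solution_initial[OF x, of s] \<tau> by simp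
  ultimately have w': "(w' has_integral (u t - x t)) {s..t}"
    by simp
  have \<eta>t: "\<eta> integrable_on {s..t}"
    using t by (intro integrable_on_subinterval[OF \<eta>]) auto
  have bound: "norm (w' r) \<le> \<eta> r * phase_norm \<tau> \<phi>" if r: "r \<in> {s..t}" for r
  proof -
    have "u (r - \<tau>) = \<phi> (r - \<tau> - s)" "x (r - \<tau>) = \<phi> (r - \<tau> - s)"
      using dde_solution_initial[OF u, of "r - \<tau>"] dde_solution_initial[OF x, of "r - \<tau>"] r t by auto
    then have "norm (w' r) = norm (B r *v \<phi> (r - \<tau> - s))"
      by (simp add: w'_def)
    also have "\<dots> \<le> onorm (\<lambda>x. B r *v x) * norm (\<phi> (r - \<tau> - s))"
      by (rule onorm[OF matrix_vector_mul_bounded_linear])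
    also have "\<dots> \<le> \<eta> r * phase_norm \<tau> \<phi>"
      using r t B[of r] nonneg[of r] by (intro mult_mono phase_norm_upper[OF \<phi>]) auto
    finally show ?thesis .
  qed
  have "norm (u t - x t) \<le> integral {s..t} (\<lambda>r. \<eta> r * phase_norm \<tau> \<phi>)"
    using integral_norm_bound_integral[OF has_integral_integrable[OF w'] _ bound]
      integrable_on_mult_left[OF \<eta>t] integral_unique[OF w'] by simp
  also have "\<dots> = integral {s..t} \<eta> * phase_norm \<tau> \<phi>"
    by simp
  also have "\<dots> \<le> integral {s..s + \<tau>} \<eta> * phase_norm \<tau> \<phi>"
    using t \<eta>t \<eta> nonneg phase_norm_nonneg[of \<tau> \<phi>] \<phi> \<tau>
    by (intro mult_right_mono integral_subset_le) auto
  finally show ?thesis .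
qed

section \<open>Summing the deviations\<close>

text \<open>
  The bound is for the right-hand side of the recursive inequality and not just for \<open>b n\<close>,
  because values of a solution inside a segment are estimated by that sum.
\<close>

lemma discrete_gronwall:
  fixes b g :: "nat \<Rightarrow> real"
  assumes "\<And>n. b n \<le> c + (\<Sum>k<n. g k * b k)" "\<And>n. g n \<ge> 0" "c \<ge> 0"
  shows "c + (\<Sum>k<n. g k * b k) \<le> c * exp (\<Sum>k<n. g k)"
proof (induction n)
  case (Suc n)
  have "c + (\<Sum>k<Suc n. g k * b k) \<le> (1 + g n) * (c + (\<Sum>k<n. g k * b k))"
    using mult_left_mono[OF assms(1)[of n] assms(2)[of n]] by (simp add: algebra_simps)
  also have "\<dots> \<le> (1 + g n) * (c * exp (\<Sum>k<n. g k))"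
    using Suc assms(2)[of n] by (intro mult_left_mono) auto
  also have "\<dots> \<le> exp (g n) * (c * exp (\<Sum>k<n. g k))"
    using assms(3) by (intro mult_right_mono exp_ge_add_one_self) auto
  also have "\<dots> = c * exp (\<Sum>k<Suc n. g k)"
    by (simp add: exp_add)
  finally show ?case .
qed simp

text \<open>
  The common source of both parts. The factor \<open>exp (2 * \<beta> * \<tau>)\<close> in \<open>C\<close> pays for replacing the
  decay at a time inside a segment by the decay at the segment's right end (one \<open>\<tau>\<close>), and for
  a deviation that arises in the step from \<open>r k\<close> to \<open>r (Suc k)\<close> but is weighted by the decay
  up to \<open>r k\<close> (another \<open>\<tau>\<close>). The integral extends to \<open>t + \<tau>\<close> because \<open>t\<close> is rounded up to
  the next \<open>r n\<close>.
\<close>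

lemma perturbed_bound:
  fixes A :: "real^2^2" and B :: "real \<Rightarrow> real^2^2"
  assumes \<tau>: "\<tau> > 0" and \<beta>: "\<beta> \<ge> 0" and K: "K \<ge> 1"
    and decay: "\<And>s \<phi> x t. s \<ge> 0 \<Longrightarrow> \<phi> \<in> phase_space \<tau> \<Longrightarrow>
        dde_solution \<tau> (\<lambda>t x. A *v x) s \<phi> x \<Longrightarrow> t \<ge> s \<Longrightarrow>
        norm (x t) \<le> K * exp (- \<beta> * (t - s)) * phase_norm \<tau> \<phi>"
    and B: "\<And>t. t \<ge> 0 \<Longrightarrow> onorm (\<lambda>x. B t *v x) \<le> \<eta> t"
    and \<eta>: "\<And>a b. a \<ge> 0 \<Longrightarrow> \<eta> integrable_on {a..b}"
    and s: "s \<ge> 0" and \<phi>: "\<phi> \<in> phase_space \<tau>"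
    and u: "dde_solution \<tau> (\<lambda>t x. A *v x + B t *v x) s \<phi> u"
    and t: "t \<ge> s"
    and C: "C = K * exp (2 * \<beta> * \<tau>)"
  shows "norm (u t) \<le>
    C * exp (- \<beta> * (t - s)) * exp (C * integral {s..t + \<tau>} \<eta>) * phase_norm \<tau> \<phi>"
proof -
  have C0: "C \<ge> 0" using C K by simp
  define r where "r k = s + real k * \<tau>" for k
  have r: "r k \<ge> s" "r k \<ge> 0" "r (Suc k) = r k + \<tau>" "r 0 = s" for k
    using s \<tau> by (auto simp: r_def algebra_simps)
  have r_mono: "r i \<le> r j" if "i \<le> j" for i j
    using that \<tau> by (simp add: r_def)
  define seg where "seg k = (\<lambda>\<theta>. u (r k + \<theta>))" for k
  define a where "a k = phase_norm \<tau> (seg k)" for k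
  have seg: "seg k \<in> phase_space \<tau>" for k
    unfolding seg_def by (rule segment_in_phase_space[OF u r(1)])
  have a0: "a k \<ge> 0" for k
    unfolding a_def using \<tau> seg by (intro phase_norm_nonneg) auto
  have u_seg: "dde_solution \<tau> (\<lambda>t x. A *v x + B t *v x) (r k) (seg k) u" for k
    unfolding seg_def by (rule dde_solution_restart[OF u r(1)])
  have decay': "norm (x t) \<le> K * exp (- \<beta> * (t - s)) * phase_norm \<tau> \<phi>"
    if "s \<ge> 0" "\<phi> \<in> phase_space \<tau>" "dde_solution \<tau> (\<lambda>t x. A *v x) s \<phi> x" "t \<ge> s - \<tau>"
    for s \<phi> x t
    using \<tau> by (intro decay_from_start_of_segment[OF _ \<beta> K that(2,3) decay[OF that(1-3)] that(4)]) auto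
  have "\<exists>x. dde_solution \<tau> (\<lambda>t x. A *v x) (r k) (seg k) x" for k
    using dde_solution_exists[OF \<tau> seg[of k] matrix_vector_mult_linear_continuous_on[of UNIV A]]
    by metis
  then obtain x where x: "\<And>k. dde_solution \<tau> (\<lambda>t x. A *v x) (r k) (seg k) (x k)"
    by metis
  have x_eq_u: "x k t = u t" if "t \<in> {r k - \<tau>..r k}" for k t
    using dde_solution_initial[OF x that] by (simp add: seg_def)
  define e where "e k = integral {r k..r (Suc k)} \<eta>" for k
  have \<eta>0: "\<eta> t \<ge> 0" if "t \<ge> 0" for t
    using B[OF that] onorm_pos_le[OF matrix_vector_mul_bounded_linear[of "B t"]] by simp
  have e0: "e k \<ge> 0" for k
    unfolding e_def using r(2) by (intro integral_nonneg \<eta> \<eta>0) (auto intro: order_trans)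
  \<comment> \<open>The range of \<open>t\<close> includes the delay interval before the start \<open>r (Suc k)\<close> of \<open>x (Suc k)\<close>,
    where this solution coincides with \<open>u\<close>; the sum for the \<open>n\<close>-th segment uses the last jump
    there.\<close>
  have jump: "norm (x (Suc k) t - x k t) \<le> K * exp (- \<beta> * (t - r (Suc k))) * (e k * a k)"
    if "t \<ge> r k" for k t
  proof -
    have sol: "dde_solution \<tau> (\<lambda>t x. A *v x) (r (Suc k))
        (\<lambda>\<theta>. seg (Suc k) \<theta> - x k (r (Suc k) + \<theta>)) (\<lambda>t. x (Suc k) t - x k t)"
      by (intro dde_solution_diff x dde_solution_restart[OF x] r_mono) auto
    have mem: "(\<lambda>\<theta>. seg (Suc k) \<theta> - x k (r (Suc k) + \<theta>)) \<in> phase_space \<tau>"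
      using seg[of "Suc k"] segment_in_phase_space[OF x[of k] r_mono[of k "Suc k"]]
      unfolding phase_space_def by (auto intro!: continuous_intros)
    have "phase_norm \<tau> (\<lambda>\<theta>. seg (Suc k) \<theta> - x k (r (Suc k) + \<theta>)) \<le> e k * a k"
    proof (rule phase_norm_least)
      fix \<theta> assume \<theta>: "\<theta> \<in> {-\<tau>..0}"
      have "norm (u (r (Suc k) + \<theta>) - x k (r (Suc k) + \<theta>))
          \<le> integral {r k..r k + \<tau>} \<eta> * phase_norm \<tau> (seg k)"
        by (rule one_step_deviation[OF \<tau> u_seg x seg])
           (use \<theta> r(2,3)[of k] in \<open>auto intro!: B \<eta>\<close>)
      then show "norm (seg (Suc k) \<theta> - x k (r (Suc k) + \<theta>)) \<le> e k * a k"
        by (simp add: seg_def e_def a_def r(3))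
    qed (use \<tau> in simp)
    moreover have "norm (x (Suc k) t - x k t) \<le> K * exp (- \<beta> * (t - r (Suc k))) *
        phase_norm \<tau> (\<lambda>\<theta>. seg (Suc k) \<theta> - x k (r (Suc k) + \<theta>))"
      using that by (intro decay'[OF r(2) mem sol]) (simp add: r(3))
    ultimately show ?thesis
      using K by (smt (verit) mult_left_mono exp_gt_zero mult_nonneg_nonneg)
  qed
  \<comment> \<open>The weights turn the convolution with the exponential kernel into a plain sum, to which the
    discrete Gronwall inequality applies.\<close>
  define b where "b k = exp (\<beta> * real k * \<tau>) * a k" for k
  define S where "S n = a 0 + (\<Sum>k<n. e k * b k)" for n
  have pointwise: "norm (u t) \<le> K * exp (\<beta> * \<tau>) * exp (- \<beta> * (t - s)) * S n"
    if t: "t \<in> {r n - \<tau>..r n}" for t n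
  proof -
    have "x n t = x 0 t + (\<Sum>k<n. x (Suc k) t - x k t)"
      by (simp add: sum_lessThan_telescope[of "\<lambda>k. x k t"])
    then have "norm (u t) \<le> norm (x 0 t) + norm (\<Sum>k<n. x (Suc k) t - x k t)"
      unfolding x_eq_u[OF t] by (simp only: norm_triangle_ineq)
    also have "\<dots> \<le> norm (x 0 t) + (\<Sum>k<n. norm (x (Suc k) t - x k t))"
      by (intro add_left_mono norm_sum)
    also have "\<dots> \<le> K * exp (- \<beta> * (t - s)) * a 0 +
        (\<Sum>k<n. K * exp (- \<beta> * (t - r (Suc k))) * (e k * a k))"
    proof (intro add_mono sum_mono jump)
      have "t \<ge> r 0 - \<tau>"
        using t r_mono[of 0 n] by simp
      then show "norm (x 0 t) \<le> K * exp (- \<beta> * (t - s)) * a 0"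
        using decay'[OF r(2) seg x, of 0 t] by (simp add: a_def r(4))
      show "r k \<le> t" if "k \<in> {..<n}" for k
        using that t r_mono[of "Suc k" n] r(3)[of k] by simp
    qed
    also have "\<dots> = K * exp (- \<beta> * (t - s)) * (a 0 + (\<Sum>k<n. exp (\<beta> * \<tau>) * (e k * b k)))"
    proof -
      have "exp (- \<beta> * (t - r (Suc k))) = exp (- \<beta> * (t - s)) * exp (\<beta> * \<tau>) * exp (\<beta> * real k * \<tau>)" for k
        by (simp add: r_def algebra_simps flip: exp_add)
      then show ?thesis
        by (simp add: b_def sum_distrib_left algebra_simps)
    qed
    also have "\<dots> \<le> K * exp (- \<beta> * (t - s)) * (exp (\<beta> * \<tau>) * S n)"
      unfolding S_def distrib_left sum_distrib_left[symmetric]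
      using K \<beta> \<tau> a0[of 0] mult_right_mono[of 1 "exp (\<beta> * \<tau>)" "a 0"]
      by (intro mult_left_mono add_right_mono) auto
    finally show ?thesis by (simp add: mult_ac)
  qed
  have S0: "S n \<ge> 0" for n
    unfolding S_def b_def using a0 e0 by (intro add_nonneg_nonneg sum_nonneg) auto
  have "b n \<le> C * a 0 + (\<Sum>k<n. (C * e k) * b k)" for n
  proof -
    have "a n \<le> C * exp (- (\<beta> * real n * \<tau>)) * S n"
      unfolding a_def
    proof (rule phase_norm_least)
      fix \<theta> assume \<theta>: "\<theta> \<in> {-\<tau>..0}"
      have "norm (seg n \<theta>) \<le> K * exp (\<beta> * \<tau>) * exp (- \<beta> * (r n + \<theta> - s)) * S n"
        unfolding seg_def using \<theta> by (intro pointwise) auto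
      also have "\<dots> = K * exp (\<beta> * \<tau> - \<beta> * (real n * \<tau> + \<theta>)) * S n"
        by (simp add: r_def flip: exp_add)
      also have "\<dots> \<le> K * exp (2 * \<beta> * \<tau> - \<beta> * real n * \<tau>) * S n"
        using K S0 \<theta> mult_left_mono[of "-\<theta>" \<tau> \<beta>] \<beta>
        by (intro mult_right_mono mult_left_mono) (auto simp: algebra_simps)
      also have "\<dots> = C * exp (- (\<beta> * real n * \<tau>)) * S n"
        by (simp add: C flip: exp_add)
      finally show "norm (seg n \<theta>) \<le> C * exp (- (\<beta> * real n * \<tau>)) * S n" .
    qed (use \<tau> in simp)
    then have "b n \<le> C * S n"
      by (simp add: b_def exp_minus field_simps)
    then show ?thesis
      by (simp add: S_def sum_distrib_left algebra_simps)
  qed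
  then have "C * a 0 + (\<Sum>k<n. (C * e k) * b k) \<le> C * a 0 * exp (\<Sum>k<n. C * e k)" for n
    using C0 e0 a0 by (intro discrete_gronwall) auto
  then have CS: "C * S n \<le> C * a 0 * exp (C * (\<Sum>k<n. e k))" for n
    by (simp add: S_def sum_distrib_left algebra_simps)
  have sum_e: "(\<Sum>k<n. e k) = integral {s..r n} \<eta>" for n
  proof (induction n)
    case (Suc n)
    then show ?case
      using Henstock_Kurzweil_Integration.integral_combine[OF r(1)[of n] r_mono[of n "Suc n"] \<eta>[OF s]]
      by (simp add: e_def)
  qed (simp add: r)
  define n where "n = nat \<lceil>(t - s) / \<tau>\<rceil>"
  have "(t - s) / \<tau> \<ge> 0" using t \<tau> by simp
  then have "(t - s) / \<tau> \<le> real n" "real n \<le> (t - s) / \<tau> + 1"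
    unfolding n_def by linarith+
  then have n: "t \<in> {r n - \<tau>..r n}" "r n \<le> t + \<tau>"
    using \<tau> by (auto simp: r_def field_simps)
  have "a 0 = phase_norm \<tau> \<phi>"
    unfolding a_def phase_norm_def
    using dde_solution_initial[OF u] by (intro SUP_cong refl) (auto simp: seg_def r(4))
  have "norm (u t) \<le> K * exp (\<beta> * \<tau>) * exp (- \<beta> * (t - s)) * S n"
    by (rule pointwise[OF n(1)])
  also have "\<dots> \<le> exp (- \<beta> * (t - s)) * (C * S n)"
    using K \<beta> \<tau> S0[of n] by (simp add: C mult_ac mult_right_mono mult_left_mono)
  also have "\<dots> \<le> exp (- \<beta> * (t - s)) * (C * a 0 * exp (C * integral {s..t + \<tau>} \<eta>))"
  proof (rule mult_left_mono)
    have "integral {s..r n} \<eta> \<le> integral {s..t + \<tau>} \<eta>"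
      using n(2) s by (intro integral_subset_le \<eta>) (auto intro!: \<eta>0)
    then have "C * a 0 * exp (C * integral {s..r n} \<eta>) \<le> C * a 0 * exp (C * integral {s..t + \<tau>} \<eta>)"
      using C0 a0[of 0] by (intro mult_left_mono) (auto intro!: mult_left_mono)
    then show "C * S n \<le> C * a 0 * exp (C * integral {s..t + \<tau>} \<eta>)"
      using CS[of n] by (simp add: sum_e)
  qed simp
  finally show ?thesis
    using \<open>a 0 = phase_norm \<tau> \<phi>\<close> by (simp add: mult_ac)
qed

theorem theorem3p3:
  fixes \<tau> :: real and A :: "real^2^2"
  assumes "\<tau> > 0"
  shows
    "(dde_stable \<tau> (\<lambda>t x. A *v x) \<longrightarrow>
        (\<forall>\<Delta>A. admissible_perturbation \<Delta>A \<longrightarrow>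
           (\<exists>\<eta> :: real \<Rightarrow> real. \<eta> integrable_on {0..} \<and>
              (\<forall>t\<ge>0. onorm (\<lambda>x. \<Delta>A t *v x) \<le> \<eta> t)) \<longrightarrow>
           dde_uniformly_stable \<tau> (\<lambda>t x. A *v x + \<Delta>A t *v x)))
     \<and>
     (dde_exp_asymp_stable \<tau> (\<lambda>t x. A *v x) \<longrightarrow>
        (\<exists>\<eta>>0. \<forall>\<Delta>A. admissible_perturbation \<Delta>A \<longrightarrow>
           (\<forall>t\<ge>0. \<forall>i j. \<bar>\<Delta>A t $ i $ j\<bar> < \<eta>) \<longrightarrow>
           dde_exp_asymp_stable \<tau> (\<lambda>t x. A *v x + \<Delta>A t *v x)))"
proof (intro conjI impI allI)
  fix \<Delta>A :: "real \<Rightarrow> real^2^2"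
  assume stable: "dde_stable \<tau> (\<lambda>t x. A *v x)"
    and "\<exists>\<eta> :: real \<Rightarrow> real. \<eta> integrable_on {0..} \<and> (\<forall>t\<ge>0. onorm (\<lambda>x. \<Delta>A t *v x) \<le> \<eta> t)"
  then obtain \<eta> :: "real \<Rightarrow> real" where \<eta>: "\<eta> integrable_on {0..}"
    and \<Delta>A: "\<And>t. t \<ge> 0 \<Longrightarrow> onorm (\<lambda>x. \<Delta>A t *v x) \<le> \<eta> t"
    by blast
  from dde_stable_imp_uniform_bound[OF assms stable] obtain K where K: "K > 0"
    "\<And>s \<phi> x t. \<phi> \<in> phase_space \<tau> \<Longrightarrow> dde_solution \<tau> (\<lambda>t x. A *v x) s \<phi> x \<Longrightarrow> t \<ge> s \<Longrightarrow>
       norm (x t) \<le> K * phase_norm \<tau> \<phi>"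
    by blast
  define C where "C = max K 1"
  define M where "M = C * exp (C * integral {0..} \<eta>)"
  have "C \<ge> 1" "M > 0"
    by (auto simp: C_def M_def)
  have int: "\<eta> integrable_on {a..b}" if "a \<ge> 0" for a b
    using that by (intro integrable_on_subinterval[OF \<eta>]) auto
  have \<eta>0: "\<eta> t \<ge> 0" if "t \<ge> 0" for t
    using \<Delta>A[OF that] onorm_pos_le[OF matrix_vector_mul_bounded_linear[of "\<Delta>A t"]] by simp
  have bound: "norm (u t) \<le> M * phase_norm \<tau> \<phi>"
    if "s \<ge> 0" and \<phi>: "\<phi> \<in> phase_space \<tau>" and "t \<ge> s"
      and u: "dde_solution \<tau> (\<lambda>t x. A *v x + \<Delta>A t *v x) s \<phi> u" for s \<phi> u t
  proof -
    have N: "phase_norm \<tau> \<psi> \<ge> 0" if "\<psi> \<in> phase_space \<tau>" for \<psi>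
      using that assms by (intro phase_norm_nonneg) auto
    have "norm (u t) \<le>
        C * exp (- 0 * (t - s)) * exp (C * integral {s..t + \<tau>} \<eta>) * phase_norm \<tau> \<phi>"
    proof (rule perturbed_bound[OF assms _ \<open>C \<ge> 1\<close> _ \<Delta>A int \<open>s \<ge> 0\<close> \<phi> u \<open>t \<ge> s\<close>])
      show "norm (x t) \<le> C * exp (- 0 * (t - s)) * phase_norm \<tau> \<psi>"
        if "\<psi> \<in> phase_space \<tau>" "dde_solution \<tau> (\<lambda>t x. A *v x) s \<psi> x" "t \<ge> s" for s \<psi> x t
        using K(2)[OF that] mult_right_mono[OF _ N[OF that(1)], of K C] by (simp add: C_def)
    qed auto
    also have "\<dots> \<le> M * phase_norm \<tau> \<phi>"
      using \<open>C \<ge> 1\<close> \<open>s \<ge> 0\<close> unfolding M_def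
      by (intro mult_right_mono[OF _ N[OF \<phi>]])
         (auto intro!: mult_left_mono integral_subset_le int \<eta> \<eta>0)
    finally show ?thesis .
  qed
  show "dde_uniformly_stable \<tau> (\<lambda>t x. A *v x + \<Delta>A t *v x)"
    unfolding dde_uniformly_stable_def
  proof (intro allI impI)
    fix \<epsilon> :: real
    assume "\<epsilon> > 0"
    have "norm (u t) < \<epsilon>"
      if "s \<ge> 0" "\<phi> \<in> phase_space \<tau>" "dde_solution \<tau> (\<lambda>t x. A *v x + \<Delta>A t *v x) s \<phi> u"
        "phase_norm \<tau> \<phi> < \<epsilon> / M" "t \<ge> s" for s \<phi> u t
      using bound[OF that(1,2,5,3)] that(4) \<open>M > 0\<close> by (simp add: field_simps)
    then show "\<exists>\<delta>>0. \<forall>s\<ge>0. \<forall>\<phi>\<in>phase_space \<tau>. \<forall>u.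
        dde_solution \<tau> (\<lambda>t x. A *v x + \<Delta>A t *v x) s \<phi> u \<longrightarrow>
        phase_norm \<tau> \<phi> < \<delta> \<longrightarrow> (\<forall>t\<ge>s. norm (u t) < \<epsilon>)"
      using \<open>\<epsilon> > 0\<close> \<open>M > 0\<close> by (intro exI[of _ "\<epsilon> / M"] conjI allI ballI impI) simp_all
  qed
next
  assume "dde_exp_asymp_stable \<tau> (\<lambda>t x. A *v x)"
  then obtain K \<beta> where "K > 0" "\<beta> > 0" and *:
    "\<forall>s\<ge>0. \<forall>\<phi>\<in>phase_space \<tau>. \<forall>x. dde_solution \<tau> (\<lambda>t x. A *v x) s \<phi> x \<longrightarrow>
       (\<forall>t\<ge>s. norm (x t) \<le> K * exp (- \<beta> * (t - s)) * phase_norm \<tau> \<phi>)"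
    unfolding dde_exp_asymp_stable_def by (elim exE conjE) (rule that)
  have decay: "norm (x t) \<le> K * exp (- \<beta> * (t - s)) * phase_norm \<tau> \<phi>"
    if "s \<ge> 0" "\<phi> \<in> phase_space \<tau>" "dde_solution \<tau> (\<lambda>t x. A *v x) s \<phi> x" "t \<ge> s" for s \<phi> x t
    using that by (intro *[rule_format])
  define L where "L = max K 1"
  define C where "C = L * exp (2 * \<beta> * \<tau>)"
  \<comment> \<open>A \<open>2 \<times> 2\<close> matrix with entries below \<open>\<eta>\<close> has operator norm at most \<open>4 * \<eta>\<close>, which makes
    the growth rate \<open>C * (4 * \<eta>)\<close> equal to half of \<open>\<beta>\<close>.\<close>
  define \<eta> where "\<eta> = \<beta> / (8 * C)"
  have "L \<ge> 1" "C > 0"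
    by (auto simp: L_def C_def)
  have "\<eta> > 0" and C\<eta>: "C * (4 * \<eta>) = \<beta> / 2"
    using \<open>C > 0\<close> \<open>\<beta> > 0\<close> by (auto simp: \<eta>_def)
  have "dde_exp_asymp_stable \<tau> (\<lambda>t x. A *v x + \<Delta>A t *v x)"
    if small: "\<forall>t\<ge>0. \<forall>i j. \<bar>\<Delta>A t $ i $ j\<bar> < \<eta>" for \<Delta>A :: "real \<Rightarrow> real^2^2"
  proof -
    have \<Delta>A: "onorm (\<lambda>x. \<Delta>A t *v x) \<le> 4 * \<eta>" if "t \<ge> 0" for t
      using onorm_le_matrix_component[of "\<Delta>A t" \<eta>] small that by (simp add: less_imp_le)
    have "norm (u t) \<le> (C * exp (\<beta> * \<tau> / 2)) * exp (- (\<beta> / 2) * (t - s)) * phase_norm \<tau> \<phi>"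
      if "s \<ge> 0" and \<phi>: "\<phi> \<in> phase_space \<tau>" and "t \<ge> s"
        and u: "dde_solution \<tau> (\<lambda>t x. A *v x + \<Delta>A t *v x) s \<phi> u" for s \<phi> u t
    proof -
      have "norm (u t) \<le>
          C * exp (- \<beta> * (t - s)) * exp (C * integral {s..t + \<tau>} (\<lambda>_. 4 * \<eta>)) * phase_norm \<tau> \<phi>"
      proof (rule perturbed_bound[OF assms _ \<open>L \<ge> 1\<close> _ \<Delta>A _ \<open>s \<ge> 0\<close> \<phi> u \<open>t \<ge> s\<close> C_def])
        show "norm (x t) \<le> L * exp (- \<beta> * (t - s)) * phase_norm \<tau> \<psi>"
          if "s \<ge> 0" "\<psi> \<in> phase_space \<tau>" "dde_solution \<tau> (\<lambda>t x. A *v x) s \<psi> x" "t \<ge> s" for s \<psi> x t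
        proof -
          have "phase_norm \<tau> \<psi> \<ge> 0"
            using that assms by (intro phase_norm_nonneg) auto
          then have "K * exp (- \<beta> * (t - s)) * phase_norm \<tau> \<psi> \<le> L * exp (- \<beta> * (t - s)) * phase_norm \<tau> \<psi>"
            by (intro mult_right_mono) (auto simp: L_def)
          then show ?thesis
            using decay[OF that] by linarith
        qed
      qed (use \<open>\<beta> > 0\<close> in auto)
      also have "C * integral {s..t + \<tau>} (\<lambda>_. 4 * \<eta>) = (C * (4 * \<eta>)) * (t + \<tau> - s)"
        using \<open>t \<ge> s\<close> assms by simp
      also have "\<dots> = \<beta> / 2 * (t + \<tau> - s)"
        by (simp only: C\<eta>)
      also have "C * exp (- \<beta> * (t - s)) * exp (\<beta> / 2 * (t + \<tau> - s)) =
          (C * exp (\<beta> * \<tau> / 2)) * exp (- (\<beta> / 2) * (t - s))"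
        by (simp add: algebra_simps add_divide_distrib diff_divide_distrib flip: exp_add)
      finally show ?thesis .
    qed
    then show ?thesis
      unfolding dde_exp_asymp_stable_def
      by (intro exI[of _ "C * exp (\<beta> * \<tau> / 2)"] exI[of _ "\<beta> / 2"] conjI allI ballI impI)
         (use \<open>C > 0\<close> \<open>\<beta> > 0\<close> in simp_all)
  qed
  then show "\<exists>\<eta>>0. \<forall>\<Delta>A. admissible_perturbation \<Delta>A \<longrightarrow>
           (\<forall>t\<ge>0. \<forall>i j. \<bar>\<Delta>A t $ i $ j\<bar> < \<eta>) \<longrightarrow>
           dde_exp_asymp_stable \<tau> (\<lambda>t x. A *v x + \<Delta>A t *v x)"
    using \<open>\<eta> > 0\<close> by blast
qed

end
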